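(* Let $\mathcal{X}\subset\{0,1\}^n$ be the set of incidence vectors of the bases of a matroid on $n$ elements, let $B\in\mathbb{R}^{n\times r}$, $Q=BB^{\mathsf T}$, $P_B=B^{\mathsf T}\operatorname{conv}(\mathcal{X})$ and $d=\dim P_B$. Then, for fixed rank $r$, the problem $\max_{x\in\mathcal{X}}x^{\mathsf T}Qx$ is solvable exactly using at most $R_{\mathrm c}\bigl(\binom n2,d\bigr)$ greedy-oracle calls. In particular, this applies to the incidence vectors of spanning trees of a connected graph, through the graphic matroid.
   Context: A greedy-oracle call computes, by the greedy algorithm, a maximum-weight base of the matroid for a given weight vector $w\in\mathbb{R}^n$ (here of the form $w=Bz$, $z\in\mathbb{R}^r$). $R_{\mathrm c}(N,d)=1$ if $d=0$ or $N=0$, and $R_{\mathrm c}(N,d)=2\sum_{j=0}^{d-1}\binom{N-1}{j}$ if $d\ge1$ and $N\ge1$. *)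

theory Defs
  imports "HOL-Analysis.Analysis"
begin

section \<open>Matroids and the greedy algorithm\<close>

text \<open>The ground set is the whole finite type, so a matroid on \<open>n\<close> elements is one over an
  index type \<open>'n\<close> with \<open>CARD('n) = n\<close>.\<close>

locale matroid =
  fixes indep :: "'e::finite set \<Rightarrow> bool"
  assumes indep_empty: "indep {}"
    and indep_subset: "\<lbrakk>indep S; T \<subseteq> S\<rbrakk> \<Longrightarrow> indep T"
    and indep_augment: "\<lbrakk>indep S; indep T; card T < card S\<rbrakk> \<Longrightarrow> \<exists>e\<in>S - T. indep (insert e T)"

definition base :: "('e set \<Rightarrow> bool) \<Rightarrow> 'e set \<Rightarrow> bool" where
  "base indep S \<longleftrightarrow> indep S \<and> (\<forall>T. indep T \<and> S \<subseteq> T \<longrightarrow> T = S)"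

definition greedy :: "('e set \<Rightarrow> bool) \<Rightarrow> 'e list \<Rightarrow> 'e set" where
  "greedy indep es = fold (\<lambda>e S. if indep (insert e S) then insert e S else S) es {}"

text \<open>The greedy algorithm scans the elements by non-increasing weight; how ties are broken is
  left to the oracle.  Elements of negative weight are not skipped, since the result is to be a
  base.\<close>

definition greedy_oracle :: "('n::finite set \<Rightarrow> bool) \<Rightarrow> (real^'n \<Rightarrow> 'n set) \<Rightarrow> bool" where
  "greedy_oracle indep g \<longleftrightarrow>
     (\<forall>w. \<exists>es. set es = UNIV \<and> distinct es \<and> sorted_wrt (\<lambda>e f. w $ f \<le> w $ e) es \<and>
               g w = greedy indep es)"

section \<open>Algorithms with access to an oracle\<close>

text \<open>A deterministic adaptive algorithm: it either stops with an output, or asks a query and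
  continues depending on the answer.  The oracle is the only way in which its behaviour can
  depend on the matroid.\<close>

datatype ('q, 'a, 'o) oracle_alg =
    Output 'o
  | Call 'q "'a \<Rightarrow> ('q, 'a, 'o) oracle_alg"

primrec run :: "('q \<Rightarrow> 'a) \<Rightarrow> ('q, 'a, 'o) oracle_alg \<Rightarrow> 'o" where
  "run oracle (Output x) = x"
| "run oracle (Call q k) = run oracle (k (oracle q))"

primrec num_calls :: "('q \<Rightarrow> 'a) \<Rightarrow> ('q, 'a, 'o) oracle_alg \<Rightarrow> nat" where
  "num_calls oracle (Output x) = 0"
| "num_calls oracle (Call q k) = Suc (num_calls oracle (k (oracle q)))"

section \<open>Maximizing a quadratic form of factored matrix\<close>

definition incidence_vector :: "'n::finite set \<Rightarrow> real^'n" where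
  "incidence_vector S = (\<chi> e. indicator S e)"

definition projected_polytope :: "real^'r^'n \<Rightarrow> (real^'n) set \<Rightarrow> (real^'r) set" where
  "projected_polytope B X = (\<lambda>x. transpose B *v x) ` (convex hull X)"

definition R_c :: "nat \<Rightarrow> nat \<Rightarrow> nat" where
  "R_c N d = (if d = 0 \<or> N = 0 then 1 else 2 * (\<Sum>j<d. (N - 1) choose j))"

text \<open>A query \<open>z\<close> stands for the greedy-oracle call with weight vector \<open>B *v z\<close>.  The algorithm
  has to be correct for every tie-breaking of the greedy algorithm.\<close>

definition solves_within ::
  "(real^'r, 'n set, real^'n) oracle_alg \<Rightarrow> real^'r^'n \<Rightarrow> ('n::finite set \<Rightarrow> bool) \<Rightarrow>
   (real^'n) set \<Rightarrow> nat \<Rightarrow> bool" where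
  "solves_within alg B indep X K \<longleftrightarrow>
     (\<forall>g. greedy_oracle indep g \<longrightarrow>
        (let Q = B ** transpose B; oracle = (\<lambda>z. g (B *v z)) in
           is_arg_max (\<lambda>x. x \<bullet> (Q *v x)) (\<lambda>x. x \<in> X) (run oracle alg) \<and>
           num_calls oracle alg \<le> K))"

section \<open>Graphs and spanning trees\<close>

text \<open>Finite undirected graphs with edges labelled by the type \<open>'e\<close>; loops and parallel edges
  are permitted, and simple graphs are the case of an injective \<open>ends\<close> with two-element values.\<close>

definition graph :: "'v set \<Rightarrow> ('e \<Rightarrow> 'v set) \<Rightarrow> bool" where
  "graph V ends \<longleftrightarrow> finite V \<and> (\<forall>e. ends e \<subseteq> V \<and> card (ends e) \<in> {1, 2})"

definition connected_by :: "'v set \<Rightarrow> ('e \<Rightarrow> 'v set) \<Rightarrow> 'e set \<Rightarrow> bool" where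
  "connected_by V ends T \<longleftrightarrow>
     V \<noteq> {} \<and> (\<forall>u\<in>V. \<forall>v\<in>V. (u, v) \<in> {(a, b). \<exists>e\<in>T. ends e = {a, b}}\<^sup>*)"

text \<open>The cycle with vertices \<open>vs\<close> and edges \<open>es\<close>, in cyclic order; a loop is a cycle of length
  one, a pair of parallel edges a cycle of length two.\<close>

definition is_cycle :: "('e \<Rightarrow> 'v set) \<Rightarrow> 'v list \<Rightarrow> 'e list \<Rightarrow> bool" where
  "is_cycle ends vs es \<longleftrightarrow>
     es \<noteq> [] \<and> length vs = length es \<and> distinct vs \<and> distinct es \<and>
     (\<forall>i<length es. ends (es ! i) = {vs ! i, vs ! (Suc i mod length es)})"

definition forest :: "('e \<Rightarrow> 'v set) \<Rightarrow> 'e set \<Rightarrow> bool" where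
  "forest ends T \<longleftrightarrow> \<not> (\<exists>vs es. is_cycle ends vs es \<and> set es \<subseteq> T)"

definition spanning_tree :: "'v set \<Rightarrow> ('e \<Rightarrow> 'v set) \<Rightarrow> 'e set \<Rightarrow> bool" where
  "spanning_tree V ends T \<longleftrightarrow> connected_by V ends T \<and> forest ends T"

end

theory Submission
  imports Defs
begin

text \<open>A base maximizing \<open>\<parallel>B\<^sup>T x\<parallel>\<close> projects to the unique maximizer \<open>p\<close>, over the projected bases, of
  the linear functional given by \<open>p\<close> itself.  On the polytope this functional agrees up to a
  constant with that of some \<open>z\<close> in a generic \<open>d\<close>-dimensional subspace \<open>M\<close>, and \<open>z\<close> may be
  perturbed within \<open>M\<close> since the maximizer is unique.  The greedy algorithm for the weights \<open>B z\<close>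
  depends only on the order of the weights, hence only on the chamber of \<open>z\<close> in the arrangement
  on \<open>M\<close> of the hyperplanes, at most one per pair of elements, where two weights agree.  So one
  query per chamber suffices, and deletion-restriction bounds the number of chambers.\<close>

section \<open>The greedy algorithm\<close>

lemma greedy_Nil [simp]: "greedy indep [] = {}"
  by (simp add: greedy_def)

lemma greedy_snoc:
  "greedy indep (es @ [x]) =
     (if indep (insert x (greedy indep es)) then insert x (greedy indep es) else greedy indep es)"
  by (simp add: greedy_def)

context matroid
begin

lemma greedy_indep: "indep (greedy indep es)"
  by (induction es rule: rev_induct) (auto simp: greedy_snoc indep_empty)

text \<open>A rejected element stays rejected: the greedy set only grows, and independence is
  hereditary.\<close>

lemma greedy_maximal:
  "e \<in> set es \<Longrightarrow> e \<notin> greedy indep es \<Longrightarrow> \<not> indep (insert e (greedy indep es))"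
proof (induction es rule: rev_induct)
  case (snoc x es)
  show ?case
  proof (cases "e = x")
    case False
    then have "\<not> indep (insert e (greedy indep es))"
      using snoc by (auto simp: greedy_snoc split: if_splits)
    then show ?thesis
      by (metis greedy_snoc indep_subset insert_mono subset_insertI)
  qed (use snoc.prems in \<open>auto simp: greedy_snoc split: if_splits\<close>)
qed simp

text \<open>Otherwise augmentation would extend the greedy set by a scanned element, against
  \<open>greedy_maximal\<close>.\<close>

lemma card_Int_le_greedy:
  assumes "indep T"
  shows "card (T \<inter> set es) \<le> card (greedy indep es)"
proof (rule ccontr)
  assume "\<not> ?thesis"
  moreover have "indep (T \<inter> set es)"
    using assms indep_subset by blast
  ultimately obtain e where "e \<in> T \<inter> set es - greedy indep es" "indep (insert e (greedy indep es))"
    using indep_augment greedy_indep by (meson not_le)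
  then show False
    using greedy_maximal by blast
qed

text \<open>Subtracting the weight of the last element makes its choice irrelevant; the price is
  a multiple of the cardinality, which the greedy set maximizes.\<close>

lemma greedy_optimal_shifted:
  fixes w :: "'e \<Rightarrow> real"
  assumes "indep T" "sorted_wrt (\<lambda>e f. w f \<le> w e) es" "\<And>e. e \<in> set es \<Longrightarrow> c \<le> w e"
  shows "(\<Sum>e\<in>T \<inter> set es. w e - c) \<le> (\<Sum>e\<in>greedy indep es. w e - c)"
  using assms(2,3)
proof (induction es arbitrary: c rule: rev_induct)
  case (snoc x es)
  \<comment> \<open>With \<open>w x\<close> as the new shift the term of \<open>x\<close> vanishes.
    Since \<open>w x\<close> is a lower bound on the weights of \<open>es\<close>, the induction
    hypothesis applies with \<open>w x\<close> for \<open>c\<close>.\<close>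
  have split: "(\<Sum>e\<in>S. w e - c) = (\<Sum>e\<in>S - {x}. w e - w x) + (w x - c) * real (card S)"
    for S :: "'e set"
  proof -
    have "(\<Sum>e\<in>S. w e - c) = (\<Sum>e\<in>S. w e - w x) + (w x - c) * real (card S)"
      by (simp add: sum_subtractf algebra_simps)
    also have "(\<Sum>e\<in>S. w e - w x) = (\<Sum>e\<in>S - {x}. w e - w x)"
      by (rule sum.mono_neutral_right) auto
    finally show ?thesis .
  qed
  have "(\<Sum>e\<in>T \<inter> set es - {x}. w e - w x) = (\<Sum>e\<in>T \<inter> set es. w e - w x)"
    by (rule sum.mono_neutral_left) auto
  moreover have "(\<Sum>e\<in>greedy indep es - {x}. w e - w x) = (\<Sum>e\<in>greedy indep es. w e - w x)"
    by (rule sum.mono_neutral_left) auto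
  moreover have "T \<inter> set (es @ [x]) - {x} = T \<inter> set es - {x}"
    "greedy indep (es @ [x]) - {x} = greedy indep es - {x}"
    by (auto simp: greedy_snoc)
  moreover have "(\<Sum>e\<in>T \<inter> set es. w e - w x) \<le> (\<Sum>e\<in>greedy indep es. w e - w x)"
    using snoc by (auto simp: sorted_wrt_append)
  moreover have "(w x - c) * real (card (T \<inter> set (es @ [x])))
      \<le> (w x - c) * real (card (greedy indep (es @ [x])))"
    using card_Int_le_greedy[OF assms(1), of "es @ [x]"] snoc.prems(2)[of x]
    by (intro mult_left_mono) auto
  ultimately show ?case
    unfolding split[of "T \<inter> _"] split[of "greedy _ _"] by simp
qed simp

lemma base_card_eq:
  assumes "base indep S" "base indep T"
  shows "card S = card T"
proof -
  have "card S \<le> card T" if ST: "base indep S" "base indep T" for S T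
  proof (rule ccontr)
    assume "\<not> ?thesis"
    then obtain e where "e \<in> S - T" "indep (insert e T)"
      using ST indep_augment[of S T] by (auto simp: base_def not_le)
    then show False
      using ST unfolding base_def by blast
  qed
  with assms show ?thesis
    by (simp add: le_antisym)
qed

lemma greedy_base:
  assumes "set es = UNIV"
  shows "base indep (greedy indep es)"
  unfolding base_def
proof (intro conjI allI impI greedy_indep)
  fix T assume T: "indep T \<and> greedy indep es \<subseteq> T"
  show "T = greedy indep es"
  proof (rule ccontr)
    assume "T \<noteq> greedy indep es"
    then obtain e where "e \<in> T" "e \<notin> greedy indep es"
      using T by blast
    then show False
      using greedy_maximal[of e es] T indep_subset[of T "insert e (greedy indep es)"] assms by auto
  qed
qed

text \<open>Bases are equicardinal, so the shift contributes equally to both sums and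
  cancels.\<close>

lemma greedy_optimal:
  fixes w :: "'e \<Rightarrow> real"
  assumes "base indep T" "sorted_wrt (\<lambda>e f. w f \<le> w e) es" "set es = UNIV"
  shows "sum w T \<le> sum w (greedy indep es)"
proof -
  define c where "c = Min (range w)"
  have "(\<Sum>e\<in>T \<inter> set es. w e - c) \<le> (\<Sum>e\<in>greedy indep es. w e - c)"
    using assms(1,2) by (intro greedy_optimal_shifted) (auto simp: base_def c_def)
  moreover have "card T = card (greedy indep es)"
    using assms by (intro base_card_eq greedy_base)
  ultimately show ?thesis
    using assms(3) by (simp add: sum_subtractf)
qed

lemma base_exists: "\<exists>S. base indep S"
  using greedy_base finite_list[of "UNIV :: 'e set"] by auto

end

section \<open>Generic subspaces and hyperplane arrangements\<close>

text \<open>A point on the hyperplane of a new functional is pushed off it along some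
  \<open>u\<close> in \<open>M\<close>, by a step small enough to keep the earlier conditions, which
  are open.\<close>

lemma avoid_hyperplanes:
  fixes A :: "'a::euclidean_space set"
  assumes "finite A" "subspace M" "\<And>a. a \<in> A \<Longrightarrow> \<exists>u\<in>M. a \<bullet> u \<noteq> 0"
    and "open U" "z \<in> U" "z \<in> M"
  shows "\<exists>y\<in>U \<inter> M. \<forall>a\<in>A. a \<bullet> y \<noteq> 0"
  using assms(1,3)
proof (induction A)
  case empty
  with assms show ?case
    by auto
next
  case (insert a A)
  then obtain y where y: "y \<in> U" "y \<in> M" "\<forall>b\<in>A. b \<bullet> y \<noteq> 0"
    by auto
  show ?case
  proof (cases "a \<bullet> y = 0")
    case True
    obtain u where u: "u \<in> M" "a \<bullet> u \<noteq> 0"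
      using insert.prems by auto
    define V where "V = U \<inter> (\<Inter>b\<in>A. {x. b \<bullet> x \<noteq> 0})"
    have "open V"
      unfolding V_def using insert.hyps(1) assms(4)
      by (intro open_Int open_INT ballI open_Collect_neq continuous_intros) auto
    moreover have "y \<in> V"
      using y by (auto simp: V_def)
    moreover have "((\<lambda>t. y + t *\<^sub>R u) \<longlongrightarrow> y + 0 *\<^sub>R u) (at 0)"
      by (intro tendsto_intros)
    ultimately have "\<forall>\<^sub>F t in at 0. y + t *\<^sub>R u \<in> V"
      using topological_tendstoD by fastforce
    then have "\<forall>\<^sub>F t in at 0. y + t *\<^sub>R u \<in> V \<and> t \<noteq> 0"
      by (simp add: eventually_conj_iff eventually_neq_at_within)
    then obtain t where t: "y + t *\<^sub>R u \<in> V" "t \<noteq> 0"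
      using eventually_happens'[OF trivial_limit_at] by blast
    have "a \<bullet> (y + t *\<^sub>R u) \<noteq> 0"
      using True u t by (simp add: inner_add_right)
    moreover have "y + t *\<^sub>R u \<in> M"
      using assms(2) y u by (simp add: subspace_add subspace_scale)
    ultimately show ?thesis
      using t by (auto simp: V_def)
  qed (use y in auto)
qed

text \<open>\<open>M\<close> grows by one vector at a time. Each sum of \<open>M\<close> and some
  \<open>W\<close> is still proper, hence lies in a hyperplane; the new vector is taken off these
  finitely many hyperplanes.\<close>

lemma subspace_avoiding:
  fixes Ws :: "'a::euclidean_space set set"
  assumes "finite Ws" "\<And>W. W \<in> Ws \<Longrightarrow> subspace W \<and> dim W + k \<le> DIM('a)" "k \<le> DIM('a)"
  shows "\<exists>M. subspace M \<and> dim M = k \<and> (\<forall>W\<in>Ws. M \<inter> W \<subseteq> {0})"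
  using assms(2,3)
proof (induction k)
  case 0
  show ?case
    by (rule exI[of _ "{0}"]) (simp add: subspace_single_0)
next
  case (Suc k)
  then obtain M where M: "subspace M" "dim M = k" "\<forall>W\<in>Ws. M \<inter> W \<subseteq> {0}"
    by fastforce
  \<comment> \<open>The extra \<open>{0}\<close> yields a hyperplane through \<open>M\<close> alone,
    which keeps the new vector out of \<open>M\<close> even if \<open>Ws\<close> is empty.\<close>
  have "\<exists>a. a \<noteq> 0 \<and> (\<forall>x\<in>M \<union> W. a \<bullet> x = 0)" if "W \<in> insert {0} Ws" for W
  proof -
    have W: "subspace W" "dim W + k < DIM('a)"
      using that Suc.prems by (auto simp: subspace_single_0 Suc_le_eq)
    define T where "T = {x + y | x y. x \<in> M \<and> y \<in> W}"
    have "dim T + dim (M \<inter> W) = dim M + dim W"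
      unfolding T_def using M(1) W(1) by (rule dim_sums_Int)
    then have "dim T < DIM('a)"
      using M W by simp
    then obtain a where a: "a \<noteq> 0" "\<And>y. y \<in> span T \<Longrightarrow> orthogonal a y"
      using orthogonal_to_subspace_exists by blast
    have "M \<union> W \<subseteq> T"
      unfolding T_def using subspace_0[OF M(1)] subspace_0[OF W(1)]
      by (force intro: exI[of _ 0])
    then show ?thesis
      using a by (meson orthogonal_def span_base subsetD)
  qed
  then have "\<forall>W\<in>insert {0} Ws. \<exists>a. a \<noteq> 0 \<and> (\<forall>x\<in>M \<union> W. a \<bullet> x = 0)"
    by blast
  then obtain f where f: "\<forall>W\<in>insert {0} Ws. f W \<noteq> 0 \<and> (\<forall>x\<in>M \<union> W. f W \<bullet> x = 0)"
    by (rule bchoice[THEN exE])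
  have "\<exists>v\<in>UNIV \<inter> UNIV. \<forall>a\<in>f ` insert {0} Ws. a \<bullet> v \<noteq> 0"
  proof (rule avoid_hyperplanes[where z = 0])
    show "\<exists>u\<in>UNIV. a \<bullet> u \<noteq> 0" if "a \<in> f ` insert {0} Ws" for a
      using that f by (intro bexI[of _ a]) auto
  qed (use assms(1) in auto)
  then obtain v where v: "\<And>W. W \<in> insert {0} Ws \<Longrightarrow> f W \<bullet> v \<noteq> 0"
    by auto
  have spanM: "span M = M"
    using M(1) by simp
  have "v \<notin> span M"
    using v[of "{0}"] f unfolding spanM by auto
  then have "dim (span (insert v M)) = Suc k"
    using M(2) by (simp add: dim_insert)
  moreover have "span (insert v M) \<inter> W \<subseteq> {0}" if W: "W \<in> Ws" for W
  proof
    fix x assume x: "x \<in> span (insert v M) \<inter> W"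
    then obtain c where c: "x - c *\<^sub>R v \<in> M"
      using spanM by (auto simp: span_breakdown_eq)
    \<comment> \<open>\<open>f W\<close> kills \<open>M\<close> and \<open>W\<close> but not
      \<open>v\<close>, so the coefficient of \<open>v\<close> is zero.\<close>
    have "f W \<bullet> (x - c *\<^sub>R v) = 0" "f W \<bullet> x = 0"
      using f W c x by auto
    then have "c = 0"
      using v[of W] W by (simp add: inner_diff_right)
    then show "x \<in> {0}"
      using c x M(3) W by auto
  qed
  ultimately show ?case
    using subspace_span by blast
qed

text \<open>By a dimension count \<open>M\<close> and the orthogonal complement of \<open>L\<close>
  span the space; \<open>z\<close> is the \<open>M\<close>-component of \<open>p\<close>, and the
  other component is invisible on \<open>L\<close>.\<close>

lemma functional_represented_in_complement:
  fixes L M :: "'a::euclidean_space set"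
  assumes "subspace L" "subspace M" "dim M = dim L" "M \<inter> {y. \<forall>x\<in>L. orthogonal x y} \<subseteq> {0}"
  shows "\<exists>z\<in>M. \<forall>x\<in>L. z \<bullet> x = p \<bullet> x"
proof -
  define W where "W = {y. \<forall>x\<in>L. orthogonal x y}"
  have W: "subspace W"
    unfolding W_def by (rule subspace_orthogonal_to_vectors)
  have "dim W + dim L = DIM('a)"
    using dim_subspace_orthogonal_to_vectors[OF assms(1) subspace_UNIV] by (simp add: W_def)
  moreover define T where "T = {x + y | x y. x \<in> M \<and> y \<in> W}"
  moreover have "dim T + dim (M \<inter> W) = dim M + dim W"
    unfolding T_def using assms(2) W by (rule dim_sums_Int)
  moreover have "dim (M \<inter> W) = 0"
    using assms(4) by (simp add: W_def)
  ultimately have "span T = UNIV"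
    using assms(3) by (simp flip: dim_eq_full)
  moreover have "subspace T"
    unfolding T_def using assms(2) W by (rule subspace_sums)
  ultimately have "p \<in> T"
    by (metis UNIV_I span_eq_iff)
  then obtain z y where "p = z + y" "z \<in> M" "y \<in> W"
    unfolding T_def by blast
  then show ?thesis
    by (intro bexI[of _ z]) (auto simp: W_def orthogonal_def inner_add_left inner_commute[of y])
qed

section \<open>Chambers of a central arrangement inside a subspace\<close>

definition generic_points :: "'a::euclidean_space set \<Rightarrow> 'a set \<Rightarrow> 'a set" where
  "generic_points M A = {z \<in> M. \<forall>a\<in>A. a \<bullet> z \<noteq> 0}"

text \<open>At a generic point no sign is zero, so this set encodes the whole sign vector, that is,
  the chamber.\<close>

definition positive_part :: "'a::euclidean_space set \<Rightarrow> 'a \<Rightarrow> 'a set" where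
  "positive_part A z = {a \<in> A. a \<bullet> z > 0}"

text \<open>The number of chambers of \<open>N\<close> central hyperplanes in general position in
  dimension \<open>d\<close>. Unlike \<open>R_c\<close> it is 0 for \<open>d = 0\<close> and
  positive \<open>N\<close>, as the recursion below requires.\<close>

definition chamber_bound :: "nat \<Rightarrow> nat \<Rightarrow> nat" where
  "chamber_bound N d = (if N = 0 then 1 else 2 * (\<Sum>j<d. (N - 1) choose j))"

lemma chamber_bound_rec:
  "chamber_bound N (Suc d) + chamber_bound N d = chamber_bound (Suc N) (Suc d)"
proof (cases N)
  case 0
  have "(\<Sum>j<Suc d. 0 choose j) = 1"
    by (subst sum.lessThan_Suc_shift) simp
  with 0 show ?thesis
    by (simp add: chamber_bound_def)
next
  case (Suc m)
  have "(\<Sum>j<Suc d. Suc m choose j) = 1 + (\<Sum>j<d. m choose Suc j) + (\<Sum>j<d. m choose j)"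
    by (subst sum.lessThan_Suc_shift) (simp add: sum.distrib)
  also have "1 + (\<Sum>j<d. m choose Suc j) = (\<Sum>j<Suc d. m choose j)"
    by (subst sum.lessThan_Suc_shift) simp
  finally show ?thesis
    using Suc by (simp add: chamber_bound_def del: sum.lessThan_Suc)
qed

text \<open>Pair differences may coincide or vanish on the chosen subspace, so fewer than
  \<open>N\<close> hyperplanes can remain.\<close>

lemma chamber_bound_le_R_c:
  assumes "n \<le> N"
  shows "chamber_bound n d \<le> R_c N d"
proof (cases "d = 0 \<or> N = 0 \<or> n = 0")
  case True
  moreover have "1 \<le> 2 * (\<Sum>j<d. (N - 1) choose j)" if "d \<noteq> 0"
    using that by (cases d) (simp_all add: sum.lessThan_Suc_shift del: sum.lessThan_Suc)
  ultimately show ?thesis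
    using assms by (auto simp: chamber_bound_def R_c_def)
next
  case False
  then have "(\<Sum>j<d. (n - 1) choose j) \<le> (\<Sum>j<d. (N - 1) choose j)"
    using assms by (intro sum_mono binomial_right_mono) simp
  with False show ?thesis
    by (simp add: chamber_bound_def R_c_def)
qed

text \<open>Deletion and restriction: a sign pattern on \<open>A\<close> extends to both sides of the hyperplane
  of \<open>a\<close> only if it is realized on that hyperplane, by a convex combination of the two
  realizations.\<close>

lemma card_positive_parts_le:
  fixes A :: "'a::euclidean_space set"
  assumes "finite A" "subspace M" "dim M \<le> d"
  shows "card (positive_part A ` generic_points M A) \<le> chamber_bound (card A) d"
  using assms
proof (induction A arbitrary: M d)
  case empty
  have "positive_part {} ` generic_points M {} \<subseteq> {{}}"
    by (auto simp: positive_part_def)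
  then have "card (positive_part {} ` generic_points M {}) \<le> card {{} :: 'a set}"
    by (intro card_mono) auto
  then show ?case
    by (simp add: chamber_bound_def)
next
  case (insert a A)
  show ?case
  proof (cases "\<exists>u\<in>M. a \<bullet> u \<noteq> 0")
    case False
    then have "generic_points M (insert a A) = {}"
      by (auto simp: generic_points_def)
    then show ?thesis
      by simp
  next
    case True
    define H where "H = M \<inter> {x. a \<bullet> x = 0}"
    have subH: "subspace H"
      unfolding H_def using insert.prems(1) by (intro subspace_inter subspace_hyperplane)
    have "H \<subset> M"
      using True by (auto simp: H_def)
    then have "dim H < dim M"
      using subH insert.prems(1) by (intro dim_psubset) (metis span_eq_iff)
    then obtain d' where d': "d = Suc d'" "dim H \<le> d'"
      using insert.prems(2) by (cases d) auto
    \<comment> \<open>\<open>F0 \<union> F1\<close> holds the patterns on \<open>A\<close> that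
      extend to \<open>a\<close> at all, \<open>F0 \<inter> F1\<close> those that extend to both
      sides; the two counts add up to \<open>card F\<close>.\<close>
    define F where "F = positive_part (insert a A) ` generic_points M (insert a A)"
    define F0 where "F0 = {T \<in> F. a \<notin> T}"
    define F1 where "F1 = (\<lambda>T. T - {a}) ` {T \<in> F. a \<in> T}"
    let ?P = "\<lambda>M. positive_part A ` generic_points M A"
    have "F \<subseteq> Pow (insert a A)"
      by (auto simp: F_def positive_part_def)
    then have finF: "finite F"
      using insert.hyps(1) by (auto intro: finite_subset)
    have finP: "finite (?P M')" for M'
      by (rule finite_subset[of _ "Pow A"]) (use insert.hyps(1) in \<open>auto simp: positive_part_def\<close>)
    have pp: "positive_part (insert a A) z - {a} = positive_part A z" for z
      using insert.hyps(2) by (auto simp: positive_part_def)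
    have gp: "z \<in> generic_points M A" if "z \<in> generic_points M (insert a A)" for z
      using that by (auto simp: generic_points_def)
    have "card F = card F0 + card {T \<in> F. a \<in> T}"
      unfolding F0_def using finF by (subst card_Un_disjoint[symmetric]) (auto intro: arg_cong[of _ _ card])
    also have "card {T \<in> F. a \<in> T} = card F1"
      unfolding F1_def by (rule card_image[symmetric]) (auto simp: inj_on_def)
    also have "card F0 + card F1 = card (F0 \<union> F1) + card (F0 \<inter> F1)"
      using finF by (intro card_Un_Int) (auto simp: F0_def F1_def)
    also have "card (F0 \<union> F1) \<le> card (?P M)"
    proof (rule card_mono[OF finP])
      show "F0 \<union> F1 \<subseteq> ?P M"
      proof
        fix T assume "T \<in> F0 \<union> F1"
        then have "\<exists>T'\<in>F. T = T' - {a}"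
          by (auto simp: F0_def F1_def)
        then obtain z where "z \<in> generic_points M (insert a A)"
          "T = positive_part (insert a A) z - {a}"
          by (auto simp: F_def)
        then show "T \<in> ?P M"
          using gp pp by auto
      qed
    qed
    also have "card (F0 \<inter> F1) \<le> card (?P H)"
    proof (rule card_mono[OF finP])
      show "F0 \<inter> F1 \<subseteq> ?P H"
      proof
        fix T assume T: "T \<in> F0 \<inter> F1"
        then obtain y where y: "y \<in> generic_points M (insert a A)"
          "T = positive_part (insert a A) y" "a \<notin> T"
          by (auto simp: F0_def F_def)
        from T obtain z where z: "z \<in> generic_points M (insert a A)"
          "T = positive_part (insert a A) z - {a}" "a \<in> positive_part (insert a A) z"
          by (auto simp: F1_def F_def)
        have T_eq: "T = positive_part A y" "T = positive_part A z"
          using y z pp by auto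
        have ay: "a \<bullet> y < 0" and az: "a \<bullet> z > 0"
          using y z by (auto simp: positive_part_def generic_points_def not_less less_le)
        \<comment> \<open>The coefficients are positive and chosen so that
          \<open>a \<bullet> s = 0\<close>.\<close>
        define s where "s = (a \<bullet> z) *\<^sub>R y + (- (a \<bullet> y)) *\<^sub>R z"
        have sM: "s \<in> M"
          using y z insert.prems(1) unfolding s_def generic_points_def
          by (intro subspace_add subspace_scale) auto
        have inner_s: "b \<bullet> s = (a \<bullet> z) * (b \<bullet> y) + (- (a \<bullet> y)) * (b \<bullet> z)" for b
          by (simp add: s_def inner_add_right inner_diff_right)
        have sign: "(b \<in> T \<longrightarrow> b \<bullet> s > 0) \<and> (b \<notin> T \<longrightarrow> b \<bullet> s < 0)" if b: "b \<in> A" for b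
        proof (cases "b \<in> T")
          case True
          then have "b \<bullet> y > 0" "b \<bullet> z > 0"
            using T_eq by (auto simp: positive_part_def)
          then have "b \<bullet> s > 0"
            unfolding inner_s using ay az by (intro add_pos_pos mult_pos_pos) auto
          with True show ?thesis
            by simp
        next
          case False
          then have "\<not> b \<bullet> y > 0" "\<not> b \<bullet> z > 0"
            using T_eq b by (auto simp: positive_part_def)
          moreover have "b \<bullet> y \<noteq> 0" "b \<bullet> z \<noteq> 0"
            using b y z by (auto simp: generic_points_def)
          ultimately have "b \<bullet> y < 0" "b \<bullet> z < 0"
            by auto
          then have "b \<bullet> s < 0"
            unfolding inner_s using ay az by (intro add_neg_neg mult_pos_neg) auto
          with False show ?thesis
            by simp
        qed
        have "s \<in> generic_points H A"
          using sM inner_s[of a] sign by (fastforce simp: generic_points_def H_def)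
        moreover have "T \<subseteq> A"
          using T_eq by (auto simp: positive_part_def)
        then have "positive_part A s = T"
          using sign by (fastforce simp: positive_part_def)
        ultimately show "T \<in> ?P H"
          by blast
      qed
    qed
    also have "card (?P M) \<le> chamber_bound (card A) d"
      using insert.IH insert.prems by blast
    also have "card (?P H) \<le> chamber_bound (card A) d'"
      using insert.IH subH d' by blast
    finally show ?thesis
      using insert.hyps d' chamber_bound_rec[of "card A" d'] by (simp add: F_def)
  qed
qed

lemma chamber_representatives:
  fixes A :: "'a::euclidean_space set"
  assumes "finite A" "subspace M" "dim M \<le> d" "card A \<le> N"
  shows "\<exists>zs. length zs \<le> R_c N d \<and> set zs \<subseteq> generic_points M A \<and>
    (\<forall>z\<in>generic_points M A. \<exists>y\<in>set zs. positive_part A y = positive_part A z)"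
proof -
  let ?G = "generic_points M A"
  have fin: "finite (positive_part A ` ?G)"
    by (rule finite_subset[of _ "Pow A"]) (use assms(1) in \<open>auto simp: positive_part_def\<close>)
  obtain C where C: "C \<subseteq> ?G" "inj_on (positive_part A) C"
    "positive_part A ` ?G = positive_part A ` C"
    using iffD1[OF subset_image_inj, OF subset_refl] by metis
  have "finite C"
    using fin C finite_imageD by metis
  then obtain zs where zs: "set zs = C" "distinct zs"
    using finite_distinct_list by blast
  have "length zs = card C"
    using zs distinct_card by fastforce
  also have "\<dots> = card (positive_part A ` ?G)"
    using C by (simp add: card_image)
  also have "\<dots> \<le> R_c N d"
    using card_positive_parts_le[OF assms(1-3)] chamber_bound_le_R_c[OF assms(4)] by (rule order_trans)
  finally have "length zs \<le> R_c N d" .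
  moreover have "\<exists>y\<in>set zs. positive_part A y = positive_part A z" if "z \<in> ?G" for z
    using that C(3) zs(1) by (metis (no_types, lifting) image_iff)
  ultimately show ?thesis
    using C(1) zs(1) by blast
qed

section \<open>Graphic matroids\<close>

definition adj :: "('e \<Rightarrow> 'v set) \<Rightarrow> 'e set \<Rightarrow> 'v rel" where
  "adj ends T = {(a, b). \<exists>e\<in>T. ends e = {a, b}}"

lemma sym_adj_rtrancl: "sym ((adj ends T)\<^sup>*)"
  by (rule sym_rtrancl) (auto simp: sym_def adj_def insert_commute)

lemma forest_subset: "forest ends T \<Longrightarrow> S \<subseteq> T \<Longrightarrow> forest ends S"
  unfolding forest_def by blast

definition simple_path :: "('e \<Rightarrow> 'v set) \<Rightarrow> 'e set \<Rightarrow> 'v list \<Rightarrow> 'e list \<Rightarrow> bool" where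
  "simple_path ends T vs es \<longleftrightarrow> length vs = Suc (length es) \<and> distinct vs \<and> set es \<subseteq> T \<and>
     (\<forall>i<length es. ends (es ! i) = {vs ! i, vs ! Suc i})"

text \<open>The path grows edge by edge; on reaching a vertex already visited it is cut back to that
  vertex.\<close>

lemma simple_path_exists:
  assumes "(a, b) \<in> (adj ends T)\<^sup>*"
  shows "\<exists>vs es. simple_path ends T vs es \<and> vs ! 0 = a \<and> vs ! length es = b"
  using assms
proof (induction rule: rtrancl_induct)
  case base
  show ?case
    by (rule exI[of _ "[a]"], rule exI[of _ "[]"]) (simp add: simple_path_def)
next
  case (step b c)
  then obtain vs es where p: "simple_path ends T vs es" "vs ! 0 = a" "vs ! length es = b"
    by blast
  show ?case
  proof (cases "c \<in> set vs")
    case True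
    then obtain i where i: "i < length vs" "vs ! i = c"
      by (auto simp: in_set_conv_nth)
    show ?thesis
      by (rule exI[of _ "take (Suc i) vs"], rule exI[of _ "take i es"])
        (use p i set_take_subset[of i es] in \<open>auto simp: simple_path_def\<close>)
  next
    case False
    obtain f where f: "f \<in> T" "ends f = {b, c}"
      using step.hyps(2) by (auto simp: adj_def)
    show ?thesis
      by (rule exI[of _ "vs @ [c]"], rule exI[of _ "es @ [f]"])
        (use p f False in \<open>auto simp: simple_path_def nth_append less_Suc_eq\<close>)
  qed
qed

lemma simple_path_distinct_edges:
  assumes "simple_path ends T vs es"
  shows "distinct es"
  unfolding distinct_conv_nth
proof (intro allI impI)
  fix i j assume ij: "i < length es" "j < length es" "i \<noteq> j"
  have inj: "vs ! k = vs ! l \<longleftrightarrow> k = l" if "k \<le> length es" "l \<le> length es" for k l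
    using assms that by (simp add: simple_path_def nth_eq_iff_index_eq)
  show "es ! i \<noteq> es ! j"
  proof
    assume "es ! i = es ! j"
    then have "{vs ! i, vs ! Suc i} = {vs ! j, vs ! Suc j}"
      using assms ij by (metis simple_path_def)
    then show False
      using ij inj[of i j] inj[of i "Suc j"] inj[of "Suc i" j] by (auto simp: doubleton_eq_iff)
  qed
qed

text \<open>A path in \<open>T\<close> between the ends of \<open>e\<close> closes up with
  \<open>e\<close> to a cycle; conversely, a cycle through \<open>e\<close> connects these ends by
  its other edges.\<close>

lemma forest_insert_iff:
  assumes "e \<notin> T" "ends e = {a, b}"
  shows "forest ends (insert e T) \<longleftrightarrow> forest ends T \<and> (a, b) \<notin> (adj ends T)\<^sup>*"
proof
  assume F: "forest ends (insert e T)"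
  have "(a, b) \<notin> (adj ends T)\<^sup>*"
  proof
    assume "(a, b) \<in> (adj ends T)\<^sup>*"
    then obtain vs es where p: "simple_path ends T vs es" "vs ! 0 = a" "vs ! length es = b"
      using simple_path_exists by metis
    \<comment> \<open>\<open>e\<close> leads from the last vertex back to the first; for
      \<open>a = b\<close> the path has no edges and \<open>e\<close> is a loop.\<close>
    have "is_cycle ends vs (es @ [e])"
      using p simple_path_distinct_edges[OF p(1)] assms
      by (auto simp: is_cycle_def simple_path_def nth_append insert_commute mod_Suc less_Suc_eq)
    moreover have "set (es @ [e]) \<subseteq> insert e T"
      using p by (auto simp: simple_path_def)
    ultimately show False
      using F unfolding forest_def by blast
  qed
  with F show "forest ends T \<and> (a, b) \<notin> (adj ends T)\<^sup>*"
    by (meson forest_subset subset_insertI)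
next
  assume F: "forest ends T \<and> (a, b) \<notin> (adj ends T)\<^sup>*"
  show "forest ends (insert e T)"
    unfolding forest_def
  proof
    assume "\<exists>vs es. is_cycle ends vs es \<and> set es \<subseteq> insert e T"
    then obtain vs es where c: "is_cycle ends vs es" and sub: "set es \<subseteq> insert e T"
      by blast
    define n where "n = length es"
    have n: "n > 0" "length vs = n" "distinct es"
      and edge: "\<And>i. i < n \<Longrightarrow> ends (es ! i) = {vs ! i, vs ! (Suc i mod n)}"
      using c by (auto simp: is_cycle_def n_def)
    have "e \<in> set es"
      using F c sub unfolding forest_def by blast
    then obtain k where k: "k < n" "es ! k = e"
      by (auto simp: in_set_conv_nth n_def)
    \<comment> \<open>Walk around the cycle starting just after \<open>e\<close>. Position
      \<open>k\<close> recurs only after \<open>n\<close> steps, so fewer steps use edges of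
      \<open>T\<close> only, and \<open>n - 1\<close> of them reach the other end of
      \<open>e\<close>.\<close>
    have "(vs ! (Suc k mod n), vs ! ((Suc k + m) mod n)) \<in> (adj ends T)\<^sup>*" if "m < n" for m
      using that
    proof (induction m)
      case (Suc m)
      define i where "i = (Suc k + m) mod n"
      have "i < n"
        using n by (simp add: i_def)
      have "i \<noteq> k"
      proof
        assume "i = k"
        then have "(k + Suc m) mod n = k mod n"
          using k by (simp add: i_def)
        then have "n dvd Suc m"
          by (metis add_diff_cancel_left' le_add1 mod_eq_dvd_iff_nat)
        then show False
          using Suc.prems by (auto dest: dvd_imp_le)
      qed
      then have "es ! i \<in> T"
        using \<open>i < n\<close> k n sub by (metis insertE n_def nth_eq_iff_index_eq nth_mem subsetD)
      moreover have "Suc i mod n = (Suc k + Suc m) mod n"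
        by (simp add: i_def mod_Suc_eq)
      ultimately have "(vs ! i, vs ! ((Suc k + Suc m) mod n)) \<in> adj ends T"
        using edge[OF \<open>i < n\<close>] by (auto simp: adj_def)
      then show ?case
        using Suc by (simp add: i_def rtrancl_into_rtrancl)
    qed simp
    from this[of "n - 1"] have "(vs ! (Suc k mod n), vs ! k) \<in> (adj ends T)\<^sup>*"
      using n k by simp
    moreover have "{a, b} = {vs ! k, vs ! (Suc k mod n)}"
      using edge[OF k(1)] k assms by simp
    ultimately show False
      using F sym_adj_rtrancl[of ends T] by (auto simp: doubleton_eq_iff dest: symD)
  qed
qed

section \<open>Components and the graphic matroid\<close>

definition component :: "('e \<Rightarrow> 'v set) \<Rightarrow> 'e set \<Rightarrow> 'v \<Rightarrow> 'v set" where
  "component ends T v = (adj ends T)\<^sup>* `` {v}"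

lemma component_eq_iff: "component ends T u = component ends T v \<longleftrightarrow> (u, v) \<in> (adj ends T)\<^sup>*"
  using sym_adj_rtrancl[of ends T] unfolding component_def
  by (auto dest: symD intro: rtrancl_trans)

text \<open>The components of \<open>S\<close> refine those of \<open>T\<close>, so taking unions
  maps the former onto the latter.\<close>

lemma card_comps_antimono:
  assumes "adj ends S \<subseteq> (adj ends T)\<^sup>*" "finite V"
  shows "card (component ends T ` V) \<le> card (component ends S ` V)"
proof -
  have "component ends T v = \<Union> (component ends T ` component ends S v)" for v
  proof -
    have "component ends T u = component ends T v" if "u \<in> component ends S v" for u
      using that assms(1) rtrancl_subset_rtrancl[OF assms(1)] sym_adj_rtrancl[of ends T]
      by (auto simp: component_eq_iff component_def dest: symD)
    moreover have "v \<in> component ends S v"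
      by (simp add: component_def)
    ultimately show ?thesis
      by blast
  qed
  then have "component ends T ` V = (\<lambda>C. \<Union> (component ends T ` C)) ` component ends S ` V"
    unfolding image_image by (rule image_cong[OF refl])
  then show ?thesis
    using assms(2) by (metis card_image_le finite_imageI)
qed

lemma component_insert:
  assumes "ends e = {a, b}"
  shows "component ends (insert e T) v =
    (if v \<in> component ends T a \<union> component ends T b then component ends T a \<union> component ends T b
     else component ends T v)"
proof -
  let ?r = "adj ends T"
  \<comment> \<open>One undirected edge adds two ordered pairs, so \<open>rtrancl_insert\<close> is
    applied twice.\<close>
  have eq: "adj ends (insert e T) = insert (a, b) (insert (b, a) ?r)"
    using assms by (auto simp: adj_def doubleton_eq_iff)
  have s: "(x, y) \<in> ?r\<^sup>* \<Longrightarrow> (y, x) \<in> ?r\<^sup>*" for x y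
    using sym_adj_rtrancl by (metis symD)
  show ?thesis
    unfolding component_def eq rtrancl_insert
    by (auto intro: s rtrancl_trans)
qed

lemma card_comps_insert:
  assumes "finite V" "ends e = {a, b}" "a \<in> V" "b \<in> V" "(a, b) \<notin> (adj ends T)\<^sup>*"
  shows "Suc (card (component ends (insert e T) ` V)) = card (component ends T ` V)"
proof -
  let ?A = "component ends T a" and ?B = "component ends T b"
  have ne: "?A \<noteq> ?B"
    using assms(5) by (simp add: component_eq_iff)
  have mem: "v \<in> component ends T u \<longleftrightarrow> component ends T v = component ends T u" for u v
    using sym_adj_rtrancl[of ends T] by (auto simp: component_eq_iff component_def dest: symD)
  have "component ends (insert e T) ` V = insert (?A \<union> ?B) (component ends T ` V - {?A, ?B})"
    using assms(3,4) unfolding component_insert[of ends, OF assms(2)] mem Un_iff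
    by (auto simp: image_iff)
  \<comment> \<open>The merged component must be new; otherwise the count would not drop by exactly
    one.\<close>
  moreover have "?A \<union> ?B \<notin> component ends T ` V"
  proof
    assume "?A \<union> ?B \<in> component ends T ` V"
    then obtain v where "?A \<union> ?B = component ends T v"
      by auto
    moreover have "a \<in> ?A" "b \<in> ?B"
      by (auto simp: component_def)
    ultimately have "a \<in> component ends T v" "b \<in> component ends T v"
      by blast+
    then show False
      using ne by (simp add: mem)
  qed
  moreover have "card (component ends T ` V - {?A, ?B}) = card (component ends T ` V) - 2"
    using assms(3,4) ne by (subst card_Diff_subset) auto
  moreover have "card (component ends T ` V) \<ge> 2"
    using card_mono[of "component ends T ` V" "{?A, ?B}"] assms(1,3,4) ne by simp
  ultimately show ?thesis
    using assms(1) by (simp add: card_insert_if)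
qed

lemma graph_ends:
  assumes "graph V ends"
  obtains a b where "ends e = {a, b}" "a \<in> V" "b \<in> V"
proof -
  have e: "ends e \<subseteq> V" "card (ends e) = 1 \<or> card (ends e) = 2"
    using assms unfolding graph_def by auto
  then obtain a b where "ends e = {a, b}"
    by (auto simp: card_1_singleton_iff card_2_iff)
  with e that show ?thesis
    by auto
qed

text \<open>Starting from singletons, every added edge merges two components, as otherwise it would
  close a cycle.\<close>

lemma card_forest:
  assumes "graph V ends" "finite T" "forest ends T"
  shows "card (component ends T ` V) + card T = card V"
  using assms(2,3)
proof (induction T)
  case empty
  have "adj ends {} = {}"
    by (simp add: adj_def)
  then have "component ends {} ` V = (\<lambda>v. {v}) ` V"
    by (simp add: component_def)
  then show ?case
    by (simp add: card_image)
next
  case (insert e T)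
  obtain a b where e: "ends e = {a, b}" "a \<in> V" "b \<in> V"
    using graph_ends[OF assms(1)] .
  then have F: "forest ends T" "(a, b) \<notin> (adj ends T)\<^sup>*"
    using insert.hyps(2) insert.prems forest_insert_iff by metis+
  have "finite V"
    using assms(1) by (simp add: graph_def)
  from card_comps_insert[OF this e F(2)] insert F(1) show ?case
    by simp
qed

lemma forest_insert_connected:
  assumes "graph V ends" "forest ends T" "\<not> forest ends (insert e T)" "ends e = {a, b}"
  shows "(a, b) \<in> (adj ends T)\<^sup>*"
proof -
  have "e \<notin> T"
    using assms(2,3) by (metis insert_absorb)
  then show ?thesis
    using assms forest_insert_iff by metis
qed

text \<open>If no edge of \<open>S\<close> extends \<open>T\<close>, every edge of \<open>S\<close>
  lies within a component of \<open>T\<close>. Then \<open>T\<close> has at most as many components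
  as \<open>S\<close>, hence by \<open>card_forest\<close> at least as many edges.\<close>

lemma matroid_forest:
  fixes ends :: "'e::finite \<Rightarrow> 'v set"
  assumes "graph V ends"
  shows "matroid (forest ends)"
proof
  show "forest ends {}"
    by (auto simp: forest_def is_cycle_def)
  show "forest ends T" if "forest ends S" "T \<subseteq> S" for S T
    using that by (rule forest_subset)
  show "\<exists>e\<in>S - T. forest ends (insert e T)"
    if ST: "forest ends S" "forest ends T" "card T < card S" for S T
  proof (rule ccontr)
    assume no: "\<not> ?thesis"
    have "adj ends S \<subseteq> (adj ends T)\<^sup>*"
    proof clarify
      fix a b assume "(a, b) \<in> adj ends S"
      then obtain e where e: "e \<in> S" "ends e = {a, b}"
        by (auto simp: adj_def)
      show "(a, b) \<in> (adj ends T)\<^sup>*"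
      proof (cases "e \<in> T")
        case True
        with e have "(a, b) \<in> adj ends T"
          by (auto simp: adj_def)
        then show ?thesis
          by blast
      next
        case False
        with no e ST assms show ?thesis
          by (intro forest_insert_connected) auto
      qed
    qed
    moreover have "finite V"
      using assms by (simp add: graph_def)
    ultimately have "card (component ends T ` V) \<le> card (component ends S ` V)"
      by (rule card_comps_antimono)
    then show False
      using ST card_forest[OF assms, of S] card_forest[OF assms, of T] by simp
  qed
qed

text \<open>By maximality the ends of every edge outside a base are already connected in it;
  conversely, any edge added to a spanning tree closes a cycle.\<close>

lemma base_forest_iff_spanning_tree:
  fixes ends :: "'e::finite \<Rightarrow> 'v set"
  assumes "graph V ends" "connected_by V ends UNIV"
  shows "base (forest ends) T \<longleftrightarrow> spanning_tree V ends T"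
proof
  assume T: "base (forest ends) T"
  then have F: "forest ends T"
    by (simp add: base_def)
  have "adj ends UNIV \<subseteq> (adj ends T)\<^sup>*"
  proof clarify
    fix a b assume "(a, b) \<in> adj ends UNIV"
    then obtain e where e: "ends e = {a, b}"
      by (auto simp: adj_def)
    show "(a, b) \<in> (adj ends T)\<^sup>*"
    proof (cases "e \<in> T")
      case True
      with e have "(a, b) \<in> adj ends T"
        by (auto simp: adj_def)
      then show ?thesis
        by blast
    next
      case False
      then have "\<not> forest ends (insert e T)"
        using T unfolding base_def by blast
      with assms(1) F show ?thesis
        using e by (rule forest_insert_connected)
    qed
  qed
  then have "(adj ends UNIV)\<^sup>* \<subseteq> (adj ends T)\<^sup>*"
    by (rule rtrancl_subset_rtrancl)
  then show "spanning_tree V ends T"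
    using assms(2) F unfolding spanning_tree_def connected_by_def adj_def[symmetric] by blast
next
  assume T: "spanning_tree V ends T"
  then have F: "forest ends T" and C: "\<And>u v. u \<in> V \<Longrightarrow> v \<in> V \<Longrightarrow> (u, v) \<in> (adj ends T)\<^sup>*"
    unfolding spanning_tree_def connected_by_def adj_def[symmetric] by blast+
  have "e \<in> T" if "forest ends S" "T \<subseteq> S" "e \<in> S" for S e
  proof (rule ccontr)
    assume "e \<notin> T"
    obtain a b where "ends e = {a, b}" "a \<in> V" "b \<in> V"
      using graph_ends[OF assms(1)] .
    moreover have "forest ends (insert e T)"
      using that by (auto intro: forest_subset)
    ultimately show False
      using C forest_insert_iff \<open>e \<notin> T\<close> by metis
  qed
  then show "base (forest ends) T"
    using F unfolding base_def by blast
qed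

section \<open>Querying one point of every chamber\<close>

abbreviation proj_base :: "real^'r^'n \<Rightarrow> 'n::finite set \<Rightarrow> real^'r" where
  "proj_base B S \<equiv> transpose B *v incidence_vector S"

text \<open>The bridge between the two sides: the functional \<open>z\<close> at a projected base is
  the weight that the greedy algorithm maximizes.\<close>

lemma inner_proj_base: "z \<bullet> proj_base B S = (\<Sum>e\<in>S. (B *v z) $ e)"
proof -
  have "z \<bullet> proj_base B S = (B *v z) \<bullet> incidence_vector S"
    by (metis dot_lmul_matrix inner_commute transpose_matrix_vector)
  also have "\<dots> = (\<Sum>e\<in>UNIV. (B *v z) $ e * indicator S e)"
    by (simp add: inner_vec_def incidence_vector_def)
  also have "\<dots> = (\<Sum>e\<in>S. (B *v z) $ e)"
    by (simp add: sum.If_cases indicator_def if_distrib cong: if_cong)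
  finally show ?thesis .
qed

lemma aff_dim_projected_polytope:
  "aff_dim (projected_polytope B (incidence_vector ` F)) = aff_dim (proj_base B ` F)"
proof -
  have "projected_polytope B X = convex hull ((\<lambda>x. transpose B *v x) ` X)" for X
    unfolding projected_polytope_def
    by (rule convex_hull_linear_image) (rule matrix_vector_mul_linear)
  then show ?thesis
    by (simp only: aff_dim_convex_hull image_image)
qed

text \<open>One vector per unordered pair, with arbitrary sign, so that the hyperplanes number at
  most \<open>n choose 2\<close>.\<close>

lemma pair_differences:
  fixes B :: "real^'r^'n::finite"
  obtains D :: "'n set \<Rightarrow> real^'r"
  where "\<And>e f. e \<noteq> f \<Longrightarrow> D {e, f} = B $ e - B $ f \<or> D {e, f} = B $ f - B $ e"
proof
  define D where "D P = (SOME v. \<exists>e f. P = {e, f} \<and> v = B $ e - B $ f)" for P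
  fix e f :: 'n
  have "\<exists>v. \<exists>e' f'. {e, f} = {e', f'} \<and> v = B $ e' - B $ f'"
    by blast
  then have "\<exists>e' f'. {e, f} = {e', f'} \<and> D {e, f} = B $ e' - B $ f'"
    unfolding D_def by (rule someI_ex)
  then show "D {e, f} = B $ e - B $ f \<or> D {e, f} = B $ f - B $ e"
    by (auto simp: doubleton_eq_iff)
qed

text \<open>The subspace \<open>M\<close> must not depend on the matroid, so it is chosen complementary to the
  orthogonal complements of the direction spaces of all polytopes that could occur.  Every
  linear functional is then represented on the polytope, up to a constant, by an element
  of \<open>M\<close>.\<close>

lemma query_points:
  fixes B :: "real^'r^'n::finite"
  shows "\<exists>zs. length zs \<le> R_c (CARD('n) choose 2) d \<and>
    (\<forall>indep g. matroid indep \<longrightarrow> greedy_oracle indep g \<longrightarrow>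
       aff_dim (projected_polytope B (incidence_vector ` {S. base indep S})) = int d \<longrightarrow>
       (\<exists>z\<in>set zs. \<forall>S. base indep S \<longrightarrow>
          norm (proj_base B S) \<le> norm (proj_base B (g (B *v z)))))"
proof (cases "d \<le> CARD('r)")
  case False
  \<comment> \<open>No polytope in this space has dimension \<open>d\<close>, so the empty list will
    do.\<close>
  have "aff_dim P \<noteq> int d" for P :: "(real^'r) set"
    using False aff_dim_le_DIM[of P] by auto
  then show ?thesis
    by (intro exI[of _ "[]"]) simp
next
  case True
  \<comment> \<open>\<open>F\<close> ranges over all set families, so the base family of every
    matroid is covered, yet \<open>Ls\<close> is finite and depends on \<open>B\<close> and
    \<open>d\<close> only.\<close>
  define Ls where "Ls = {L. \<exists>S F. L = span ((\<lambda>x. x - proj_base B S) ` proj_base B ` F) \<and> dim L = d}"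
  define orth where "orth L = {y. \<forall>x\<in>L. orthogonal x y}" for L :: "(real^'r) set"
  have "Ls \<subseteq> range (\<lambda>(S, F). span ((\<lambda>x. x - proj_base B S) ` proj_base B ` F))"
    by (auto simp: Ls_def image_iff)
  then have "finite Ls"
    by (rule finite_subset) simp
  have "subspace W \<and> dim W + d \<le> DIM(real^'r)" if W: "W \<in> orth ` Ls" for W
  proof -
    obtain L where L: "W = orth L" "L \<in> Ls"
      using W by blast
    then have L: "W = orth L" "subspace L" "dim L = d"
      unfolding Ls_def using subspace_span by blast+
    have "dim W + dim L = DIM(real^'r)"
      using dim_subspace_orthogonal_to_vectors[OF L(2) subspace_UNIV] by (simp add: L(1) orth_def)
    moreover have "subspace W"
      unfolding L(1) orth_def by (rule subspace_orthogonal_to_vectors)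
    ultimately show ?thesis
      using L(3) by simp
  qed
  then obtain M where M: "subspace M" "dim M = d" "\<forall>W\<in>orth ` Ls. M \<inter> W \<subseteq> {0}"
    using subspace_avoiding[of "orth ` Ls" d] \<open>finite Ls\<close> True by auto
  obtain D :: "'n set \<Rightarrow> real^'r"
    where D: "\<And>e f. e \<noteq> f \<Longrightarrow> D {e, f} = B $ e - B $ f \<or> D {e, f} = B $ f - B $ e"
    using pair_differences[of B] by blast
  \<comment> \<open>A difference vanishing on \<open>M\<close> would leave no generic point; it is
    dropped, since it only means a permanent tie of two weights on \<open>M\<close>.\<close>
  define A where "A = {a \<in> D ` {P. card P = 2}. \<exists>u\<in>M. a \<bullet> u \<noteq> 0}"
  have "finite A"
    by (simp add: A_def)
  have "card A \<le> card (D ` {P. card P = 2})"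
    unfolding A_def by (intro card_mono) auto
  also have "\<dots> \<le> card {P :: 'n set. card P = 2}"
    by (intro card_image_le) simp
  also have "\<dots> = CARD('n) choose 2"
    using n_subsets[of "UNIV :: 'n set" 2] by simp
  finally obtain zs where zs: "length zs \<le> R_c (CARD('n) choose 2) d"
    "set zs \<subseteq> generic_points M A"
    "\<forall>y\<in>generic_points M A. \<exists>z\<in>set zs. positive_part A z = positive_part A y"
    using chamber_representatives[OF \<open>finite A\<close> M(1)] M(2) by blast
  have same_order: "(B *v y) $ f \<le> (B *v y) $ e"
    if z: "z \<in> generic_points M A" and y: "y \<in> generic_points M A"
      and eq: "positive_part A z = positive_part A y" and le: "(B *v z) $ f \<le> (B *v z) $ e"
    for y z e f
  proof (cases "e = f")
    case False
    define a where "a = D {e, f}"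
    have a: "a = B $ e - B $ f \<or> a = B $ f - B $ e"
      unfolding a_def by (rule D[OF False])
    have mem: "a \<in> D ` {P. card P = 2}"
      using False by (auto simp: a_def)
    show ?thesis
    proof (cases "a \<in> A")
      case True
      then have "a \<bullet> z > 0 \<longleftrightarrow> a \<bullet> y > 0" "a \<bullet> z \<noteq> 0" "a \<bullet> y \<noteq> 0"
        using z y eq by (auto simp: generic_points_def positive_part_def)
      then show ?thesis
        using a le by (auto simp: matrix_vector_mul_component inner_diff_left)
    next
      case False
      then have "a \<bullet> y = 0"
        using mem y by (auto simp: A_def generic_points_def)
      then show ?thesis
        using a by (auto simp: matrix_vector_mul_component inner_diff_left)
    qed
  qed simp
  have "\<exists>z\<in>set zs. \<forall>S. base indep S \<longrightarrow> norm (proj_base B S) \<le> norm (proj_base B (g (B *v z)))"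
    if mat: "matroid indep" and g: "greedy_oracle indep g"
      and dim: "aff_dim (projected_polytope B (incidence_vector ` {S. base indep S})) = int d"
    for indep g
  proof -
    interpret matroid indep by (rule mat)
    define P where "P = proj_base B ` {S. base indep S}"
    have "finite P" "P \<noteq> {}"
      using base_exists by (auto simp: P_def)
    then obtain S0 where S0: "base indep S0" "\<And>p. p \<in> P \<Longrightarrow> norm p \<le> norm (proj_base B S0)"
      using Max_in[of "norm ` P"] Max_ge[of "norm ` P"] unfolding P_def by fastforce
    define p where "p = proj_base B S0"
    have "p \<in> P"
      using S0 by (auto simp: p_def P_def)
    define L where "L = span ((\<lambda>x. x - p) ` P)"
    have "dim L = d"
      using dim aff_dim_eq_dim_subtract[of p P] hull_inc[OF \<open>p \<in> P\<close>]
      by (simp add: aff_dim_projected_polytope P_def L_def)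
    then have "L \<in> Ls"
      unfolding Ls_def L_def p_def P_def by blast
    then obtain z0 where z0: "z0 \<in> M" "\<forall>x\<in>L. z0 \<bullet> x = p \<bullet> x"
      using functional_represented_in_complement[of L M p] M \<open>dim L = d\<close>
      by (auto simp: L_def orth_def)
    \<comment> \<open>The functionals with unique maximizer \<open>p\<close> over \<open>P\<close>:
      an open set, as \<open>P\<close> is finite.\<close>
    define U where "U = (\<Inter>q\<in>P - {p}. {z. z \<bullet> q < z \<bullet> p})"
    have "open U"
      unfolding U_def using \<open>finite P\<close>
      by (intro open_INT ballI open_Collect_less continuous_intros) auto
    moreover have "z0 \<in> U"
      unfolding U_def
    proof clarify
      fix q assume q: "q \<in> P" "q \<noteq> p"
      have "q - p \<in> L"
        unfolding L_def using q(1) by (intro span_base) auto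
      \<comment> \<open>Expand the positive square of \<open>q - p\<close> and use that
        \<open>q\<close> is no longer than \<open>p\<close>.\<close>
      moreover have "p \<bullet> q < p \<bullet> p"
      proof -
        have "norm q \<le> norm p"
          using S0(2) q(1) by (simp add: p_def)
        then have "q \<bullet> q \<le> p \<bullet> p"
          by (simp add: norm_le)
        moreover have "(q - p) \<bullet> (q - p) > 0"
          using q(2) by simp
        ultimately show ?thesis
          by (simp add: inner_diff_left inner_diff_right inner_commute)
      qed
      ultimately show "z0 \<bullet> q < z0 \<bullet> p"
        using z0(2) by (fastforce simp: inner_diff_right)
    qed
    ultimately obtain y where y: "y \<in> U" "y \<in> generic_points M A"
      using avoid_hyperplanes[OF \<open>finite A\<close> M(1), of U z0] z0(1)
      by (auto simp: A_def generic_points_def)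
    then obtain z where z: "z \<in> set zs" "positive_part A z = positive_part A y"
      using zs(3) by blast
    obtain es where es: "set es = UNIV" "g (B *v z) = greedy indep es"
      and sorted: "sorted_wrt (\<lambda>e f. (B *v z) $ f \<le> (B *v z) $ e) es"
      using g unfolding greedy_oracle_def by blast
    \<comment> \<open>The scan order that the oracle used at \<open>z\<close> is also valid at
      \<open>y\<close>, whatever ties it broke, so its answer is optimal for \<open>y\<close> and
      projects to \<open>p\<close>.\<close>
    have "sorted_wrt (\<lambda>e f. (B *v y) $ f \<le> (B *v y) $ e) es"
      using sorted by (rule sorted_wrt_mono_rel[rotated]) (use same_order z y zs(2) in blast)
    then have "(\<Sum>e\<in>S0. (B *v y) $ e) \<le> (\<Sum>e\<in>greedy indep es. (B *v y) $ e)"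
      using S0(1) es(1) by (intro greedy_optimal) auto
    then have "y \<bullet> p \<le> y \<bullet> proj_base B (greedy indep es)"
      unfolding inner_proj_base p_def .
    moreover have "proj_base B (greedy indep es) \<in> P"
      using greedy_base[OF es(1)] by (auto simp: P_def)
    moreover have "y \<bullet> q < y \<bullet> p" if "q \<in> P" "q \<noteq> p" for q
      using y(1) that unfolding U_def by blast
    ultimately have "proj_base B (g (B *v z)) = p"
      unfolding es(2) by (meson not_le)
    then have "\<forall>S. base indep S \<longrightarrow> norm (proj_base B S) \<le> norm (proj_base B (g (B *v z)))"
      using S0(2) unfolding p_def P_def by auto
    with z(1) show ?thesis
      by blast
  qed
  with zs(1) show ?thesis
    by blast
qed

section \<open>The non-adaptive algorithm and its correctness\<close>

primrec query_all :: "('a list \<Rightarrow> 'o) \<Rightarrow> 'q list \<Rightarrow> 'a list \<Rightarrow> ('q, 'a, 'o) oracle_alg" where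
  "query_all h [] as = Output (h as)"
| "query_all h (q # qs) as = Call q (\<lambda>a. query_all h qs (as @ [a]))"

lemma run_query_all: "run f (query_all h qs as) = h (as @ map f qs)"
  by (induction qs arbitrary: as) auto

lemma num_calls_query_all: "num_calls f (query_all h qs as) = length qs"
  by (induction qs arbitrary: as) auto

lemma inner_factored_matrix:
  fixes B :: "real^'r^'n"
  shows "x \<bullet> ((B ** transpose B) *v x) = (norm (transpose B *v x))\<^sup>2"
proof -
  have "x \<bullet> ((B ** transpose B) *v x) = x \<bullet> (B *v (transpose B *v x))"
    by (metis matrix_vector_mul_assoc)
  also have "\<dots> = (transpose B *v x) \<bullet> (transpose B *v x)"
    by (simp add: transpose_matrix_vector dot_lmul_matrix)
  finally show ?thesis
    by (simp add: power2_norm_eq_inner)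
qed

text \<open>Computed from \<open>B\<close> and the oracle's answers alone, without access to the
  matroid.\<close>

definition best_answer :: "real^'r^'n \<Rightarrow> 'n::finite set list \<Rightarrow> real^'n" where
  "best_answer B Ss = incidence_vector (arg_max_on (\<lambda>S. norm (proj_base B S)) (set Ss))"

lemma greedy_oracle_base:
  assumes "matroid indep" "greedy_oracle indep g"
  shows "base indep (g w)"
proof -
  interpret matroid indep by (rule assms(1))
  show ?thesis
    using assms(2) greedy_base unfolding greedy_oracle_def by metis
qed

lemma solves_within_matroid:
  "\<exists>alg. \<forall>(B :: real^'r^'n::finite) indep d. matroid indep \<longrightarrow>
     aff_dim (projected_polytope B (incidence_vector ` {S. base indep S})) = int d \<longrightarrow>
     solves_within (alg B d) B indep (incidence_vector ` {S. base indep S})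
       (R_c (CARD('n) choose 2) d)"
proof -
  have "\<forall>(B :: real^'r^'n) d. \<exists>zs. length zs \<le> R_c (CARD('n) choose 2) d \<and>
    (\<forall>indep g. matroid indep \<longrightarrow> greedy_oracle indep g \<longrightarrow>
       aff_dim (projected_polytope B (incidence_vector ` {S. base indep S})) = int d \<longrightarrow>
       (\<exists>z\<in>set zs. \<forall>S. base indep S \<longrightarrow>
          norm (proj_base B S) \<le> norm (proj_base B (g (B *v z)))))"
    by (intro allI query_points)
  \<comment> \<open>Choice makes the query list a function of \<open>B\<close> and \<open>d\<close>
    only, fixed before the matroid is given.\<close>
  then obtain zs where zs: "\<And>(B :: real^'r^'n) d. length (zs B d) \<le> R_c (CARD('n) choose 2) d"
    "\<And>(B :: real^'r^'n) d indep g. matroid indep \<Longrightarrow> greedy_oracle indep g \<Longrightarrow>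
       aff_dim (projected_polytope B (incidence_vector ` {S. base indep S})) = int d \<Longrightarrow>
       \<exists>z\<in>set (zs B d). \<forall>S. base indep S \<longrightarrow>
          norm (proj_base B S) \<le> norm (proj_base B (g (B *v z)))"
    by metis
  define alg where "alg B d = query_all (best_answer B) (zs B d) []" for B d
  have "solves_within (alg B d) B indep (incidence_vector ` {S. base indep S})
       (R_c (CARD('n) choose 2) d)"
    if mat: "matroid indep"
      and dim: "aff_dim (projected_polytope B (incidence_vector ` {S. base indep S})) = int d"
    for B :: "real^'r^'n" and indep d
    unfolding solves_within_def Let_def
  proof (intro allI impI conjI)
    fix g assume g: "greedy_oracle indep g"
    let ?ask = "\<lambda>z. g (B *v z)"
    let ?Ss = "map ?ask (zs B d)"
    let ?S = "arg_max_on (\<lambda>S. norm (proj_base B S)) (set ?Ss)"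
    obtain z where z: "z \<in> set (zs B d)"
      "\<And>S. base indep S \<Longrightarrow> norm (proj_base B S) \<le> norm (proj_base B (?ask z))"
      using zs(2)[OF mat g dim] by blast
    \<comment> \<open>\<open>arg_max_on\<close> is a choice, so a maximizer among the answers has to
      be exhibited first.\<close>
    have "is_arg_max (\<lambda>S. norm (proj_base B S)) (\<lambda>S. S \<in> set ?Ss) (?ask z)"
      using z greedy_oracle_base[OF mat g] by (auto simp: is_arg_max_linorder)
    then have "is_arg_max (\<lambda>S. norm (proj_base B S)) (\<lambda>S. S \<in> set ?Ss) ?S"
      unfolding arg_max_on_def arg_max_def by (rule someI)
    then have S: "?S \<in> set ?Ss" "norm (proj_base B (?ask z)) \<le> norm (proj_base B ?S)"
      using z(1) by (auto simp: is_arg_max_linorder)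
    then have "base indep ?S"
      using greedy_oracle_base[OF mat g] by auto
    moreover have "norm (proj_base B T) \<le> norm (proj_base B ?S)" if "base indep T" for T
      using z(2)[OF that] S(2) by simp
    \<comment> \<open>The objective is the squared norm of the projection, so comparing norms
      suffices.\<close>
    ultimately show "is_arg_max (\<lambda>x. x \<bullet> ((B ** transpose B) *v x))
        (\<lambda>x. x \<in> incidence_vector ` {S. base indep S}) (run ?ask (alg B d))"
      unfolding alg_def run_query_all best_answer_def inner_factored_matrix is_arg_max_linorder
      by (auto intro!: power_mono)
    show "num_calls ?ask (alg B d) \<le> R_c (CARD('n) choose 2) d"
      using zs(1) by (simp add: alg_def num_calls_query_all)
  qed
  then show ?thesis
    by blast
qed

theorem corollary5p5:
  shows "\<exists>alg :: real^'r^'n \<Rightarrow> nat \<Rightarrow> (real^'r, 'n::finite set, real^'n) oracle_alg.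
    (\<forall>(B :: real^'r^'n) (indep :: 'n set \<Rightarrow> bool) X d.
       matroid indep \<longrightarrow>
       X = incidence_vector ` {S. base indep S} \<longrightarrow>
       aff_dim (projected_polytope B X) = int d \<longrightarrow>
       solves_within (alg B d) B indep X (R_c (CARD('n) choose 2) d)) \<and>
    (\<forall>(B :: real^'r^'n) (V :: 'v set) (ends :: 'n \<Rightarrow> 'v set) X d.
       graph V ends \<longrightarrow>
       connected_by V ends UNIV \<longrightarrow>
       X = incidence_vector ` {T. spanning_tree V ends T} \<longrightarrow>
       aff_dim (projected_polytope B X) = int d \<longrightarrow>
       matroid (forest ends) \<and>
       {T. base (forest ends) T} = {T. spanning_tree V ends T} \<and>
       solves_within (alg B d) B (forest ends) X (R_c (CARD('n) choose 2) d))"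
proof -
  obtain alg :: "real^'r^'n \<Rightarrow> nat \<Rightarrow> (real^'r, 'n set, real^'n) oracle_alg" where alg:
    "\<And>B indep d. matroid indep \<Longrightarrow>
       aff_dim (projected_polytope B (incidence_vector ` {S. base indep S})) = int d \<Longrightarrow>
       solves_within (alg B d) B indep (incidence_vector ` {S. base indep S})
         (R_c (CARD('n) choose 2) d)"
    using solves_within_matroid by blast
  show ?thesis
  proof (rule exI[of _ alg], intro conjI allI impI)
    fix V :: "'v set" and ends :: "'n \<Rightarrow> 'v set"
    assume G: "graph V ends" "connected_by V ends UNIV"
    show "matroid (forest ends)"
      using G(1) by (rule matroid_forest)
    show eq: "{T. base (forest ends) T} = {T. spanning_tree V ends T}"
      using base_forest_iff_spanning_tree[OF G] by simp
    fix B :: "real^'r^'n" and X d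
    assume "X = incidence_vector ` {T. spanning_tree V ends T}"
      "aff_dim (projected_polytope B X) = int d"
    \<comment> \<open>The same algorithm serves graphs, since the spanning trees are the bases of
      the graphic matroid.\<close>
    then show "solves_within (alg B d) B (forest ends) X (R_c (CARD('n) choose 2) d)"
      using alg[OF matroid_forest[OF G(1)]] by (simp add: eq)
  qed (simp add: alg)
qed

end
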